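(* Let $\mathcal{A}$ be a complex unital Banach algebra with involution $*$, and let $a,w\in\mathcal{A}$. Then the following are equivalent: (1) $a$ is a generalized $w$-EP element. (2) There exists $p\in\mathcal{A}$ with $p^2=p=p^*$ such that $aw+p$ is invertible in $\mathcal{A}$, $1-p\in\mathcal{A}w$, and $awp=paw$ is quasinilpotent.
   Context: An involution is a conjugate-linear map $*$ with $(xy)^*=y^*x^*$ and $x^{**}=x$. $\mathcal{A}w=\{uw: u\in\mathcal{A}\}$. An element $u\in\mathcal{A}$ is quasinilpotent if $\lim_{n\to\infty}\|u^n\|^{1/n}=0$. An element $a$ is a generalized $w$-EP element if there exists $x\in\mathcal{A}$ with $a(wx)^2=x$, $(awxw)^*=awxw$, $(xwaw)^*=xwaw$ and $\lim_{n\to\infty}\|(aw)^n-xw(aw)^{n+1}\|^{1/n}=0$. *)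

theory Defs
  imports Complex_Main
begin

(* Complex unital Banach algebras, not assumed commutative. The complex scalar multiplication
   extends the real one that banach already carries. The unit is nonzero (ring_1),
   but norm 1 = 1 is not required, hence real_normed_algebra rather than real_normed_algebra_1. *)
class complex_banach_algebra_1 = real_algebra_1 + real_normed_algebra + banach +
  fixes scaleC :: "complex \<Rightarrow> 'a \<Rightarrow> 'a"
  assumes scaleC_add_right: "scaleC c (x + y) = scaleC c x + scaleC c y"
    and scaleC_add_left: "scaleC (c + d) x = scaleC c x + scaleC d x"
    and scaleC_scaleC: "scaleC c (scaleC d x) = scaleC (c * d) x"
    and scaleC_of_real: "scaleC (of_real r) x = scaleR r x"
    and mult_scaleC_left: "scaleC c x * y = scaleC c (x * y)"
    and mult_scaleC_right: "x * scaleC c y = scaleC c (x * y)"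
    and norm_scaleC: "norm (scaleC c x) = cmod c * norm x"

(* No continuity or isometry of the involution is assumed. *)
definition involution :: "('a::complex_banach_algebra_1 \<Rightarrow> 'a) \<Rightarrow> bool" where
  "involution star \<longleftrightarrow>
    (\<forall>x y. star (x + y) = star x + star y) \<and>
    (\<forall>c x. star (scaleC c x) = scaleC (cnj c) (star x)) \<and>
    (\<forall>x y. star (x * y) = star y * star x) \<and>
    (\<forall>x. star (star x) = x)"

definition invertible_element :: "'a::ring_1 \<Rightarrow> bool" where
  "invertible_element u \<longleftrightarrow> (\<exists>v. u * v = 1 \<and> v * u = 1)"

definition quasinilpotent :: "'a::complex_banach_algebra_1 \<Rightarrow> bool" where
  "quasinilpotent u \<longleftrightarrow> (\<lambda>n. root n (norm (u ^ n))) \<longlonglongrightarrow> 0"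

definition left_multiples :: "'a::ring_1 \<Rightarrow> 'a set" where
  "left_multiples w = {u * w | u. True}"

definition generalized_EP ::
  "('a::complex_banach_algebra_1 \<Rightarrow> 'a) \<Rightarrow> 'a \<Rightarrow> 'a \<Rightarrow> bool" where
  "generalized_EP star w a \<longleftrightarrow>
    (\<exists>x. a * (w * x)^2 = x \<and>
         star (a * w * x * w) = a * w * x * w \<and>
         star (x * w * a * w) = x * w * a * w \<and>
         (\<lambda>n. root n (norm ((a * w) ^ n - x * w * (a * w) ^ (n + 1)))) \<longlonglongrightarrow> 0)"

end

(* Put b = a w and y = x w. The defining conditions of x say that b y\<^sup>2 = y, that b y and y b are
   self-adjoint, and that b\<^sup>n - y b\<^sup>n\<^sup>+\<^sup>1 tends to 0 superexponentially. Since y = b\<^sup>n y\<^sup>n\<^sup>+\<^sup>1, the last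
   condition forces y b y = y and y b b y = b y; taking adjoints of b y y b = y b then yields
   b y = y b. The projection is p = 1 - b y, and b + p splits into b (1 - p), with inverse y on the
   corner of 1 - p, and p (1 + b p), which a Neumann series inverts on the corner of p.
   Conversely, if 1 - p = u w, take x = (b + p)\<^sup>-\<^sup>1 (1 - p) u. *)
theory Submission
  imports Defs
begin

section \<open>Superexponential decay and the Neumann series\<close>

lemma root_norm_tendsto_0_eventually_le:
  fixes d :: "nat \<Rightarrow> 'a::real_normed_vector"
  assumes "(\<lambda>n. root n (norm (d n))) \<longlonglongrightarrow> 0" and "0 < e"
  shows "\<forall>\<^sub>F n in sequentially. norm (d n) \<le> e ^ n"
  \<comment> \<open>Restricting to \<open>n > 0\<close> matters: \<open>root 0\<close> is constantly
    0, so taking the power undoes the root only for positive \<open>n\<close>.\<close>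
  using order_tendstoD(2)[OF assms] eventually_gt_at_top[of 0]
proof eventually_elim
  case (elim n)
  then have "root n (norm (d n)) ^ n \<le> e ^ n"
    by (intro power_mono) auto
  with elim show ?case by simp
qed

lemma norm_power_mult_le:
  fixes y c :: "'a::{real_normed_algebra, monoid_mult}"
  shows "norm (y ^ n * c) \<le> norm y ^ n * norm c"
proof (induction n)
  case (Suc n)
  have "norm (y ^ Suc n * c) \<le> norm y * norm (y ^ n * c)"
    using norm_mult_ineq[of y "y ^ n * c"] by (simp add: mult.assoc)
  also have "\<dots> \<le> norm y * (norm y ^ n * norm c)"
    by (intro mult_left_mono Suc.IH) simp
  finally show ?case by (simp add: mult.assoc)
qed simp

text \<open>Superexponential decay of \<open>d n\<close> beats the at most geometric growth of
  \<open>y ^ n * c\<close>. This turns the limit condition into exact algebraic identities.\<close>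

lemma eq_0_if_root_norm_tendsto_0:
  fixes y c z :: "'a::{real_normed_algebra, monoid_mult}"
  assumes d: "(\<lambda>n. root n (norm (d n))) \<longlonglongrightarrow> 0"
    and z: "\<And>n. z = d n * (y ^ n * c)"
  shows "z = 0"
proof -
  \<comment> \<open>Chosen so that \<open>e * norm y\<close> is at most 1/2; the summand 1 avoids
    division by zero when \<open>y = 0\<close>.\<close>
  define e where "e = 1 / (2 * (norm y + 1))"
  have pos: "norm y + 1 > 0" using norm_ge_zero[of y] by linarith
  then have e: "e > 0" and e_half: "e * (norm y + 1) = 1 / 2" by (auto simp: e_def field_simps)
  have ey: "e * norm y \<le> 1 / 2" using e e_half by (simp add: algebra_simps)
  have "\<forall>\<^sub>F n in sequentially. norm z \<le> (1/2) ^ n * norm c"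
    using root_norm_tendsto_0_eventually_le[OF d e]
  proof eventually_elim
    case (elim n)
    have "norm z \<le> norm (d n) * norm (y ^ n * c)"
      using norm_mult_ineq z by metis
    also have "\<dots> \<le> e ^ n * (norm y ^ n * norm c)"
      by (intro mult_mono elim norm_power_mult_le) (use e in auto)
    also have "\<dots> = (e * norm y) ^ n * norm c"
      by (simp add: power_mult_distrib)
    also have "\<dots> \<le> (1/2) ^ n * norm c"
      by (intro mult_right_mono power_mono ey) (use e in auto)
    finally show ?case .
  qed
  moreover have "(\<lambda>n. (1/2) ^ n * norm c) \<longlonglongrightarrow> 0"
    by (intro tendsto_mult_left_zero LIMSEQ_power_zero) auto
  ultimately have "norm z \<le> 0"
    by (intro tendsto_lowerbound[of _ 0 sequentially]) auto
  then show ?thesis by simp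
qed

text \<open>The powers of \<open>q\<close> are eventually dominated by those of 1/2, so the Neumann
  series converges even if \<open>norm q\<close> is large.\<close>

lemma invertible_element_one_minus:
  fixes q :: "'a::{real_normed_algebra, real_algebra_1, banach}"
  assumes "(\<lambda>n. root n (norm (q ^ n))) \<longlonglongrightarrow> 0"
  shows "invertible_element (1 - q)"
proof -
  have "\<forall>\<^sub>F n in sequentially. norm (q ^ n) \<le> (1/2) ^ n"
    by (rule root_norm_tendsto_0_eventually_le[OF assms]) simp
  then have sm: "summable (\<lambda>n. q ^ n)"
    by (rule summable_comparison_test_ev) (simp add: summable_geometric)
  then have sm': "summable (\<lambda>n. q ^ Suc n)"
    by (simp only: summable_Suc_iff)
  have split: "(\<Sum>n. q ^ n) = 1 + (\<Sum>n. q ^ Suc n)"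
    using suminf_split_head[OF sm] by simp
  have "q * (\<Sum>n. q ^ n) = (\<Sum>n. q ^ Suc n)"
    using suminf_mult[OF sm, of q] by simp
  moreover have "(\<Sum>n. q ^ n) * q = (\<Sum>n. q ^ Suc n)"
    using suminf_mult2[OF sm, of q] by (simp add: power_commutes)
  ultimately have "(1 - q) * (\<Sum>n. q ^ n) = 1" "(\<Sum>n. q ^ n) * (1 - q) = 1"
    using split by (simp_all add: algebra_simps)
  then show ?thesis unfolding invertible_element_def by blast
qed

section \<open>Commuting idempotents and invertibility\<close>

lemma quasinilpotent_minus: "quasinilpotent (- q) \<longleftrightarrow> quasinilpotent q"
proof -
  have "norm ((- q) ^ n) = norm (q ^ n)" for n
    by (cases "even n") simp_all
  then show ?thesis by (simp add: quasinilpotent_def)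
qed

lemma commute_inverse:
  fixes c u s :: "'a::monoid_mult"
  assumes "s * u = 1" "u * s = 1" "c * s = s * c"
  shows "c * u = u * c"
proof -
  have "c * u = u * (s * c) * u" using assms(2) by (simp flip: mult.assoc)
  also have "\<dots> = u * c * (s * u)" by (simp add: assms(3)[symmetric] mult.assoc)
  finally show ?thesis by (simp add: assms(1))
qed

lemma power_mult_idempotent:
  fixes b p :: "'a::monoid_mult"
  assumes "b * p = p * b" "p * p = p" "n > 0"
  shows "(b * p) ^ n = b ^ n * p"
proof -
  have "p ^ n = p" using \<open>n > 0\<close>
    by (induction n rule: nat_induct_non_zero) (simp_all add: assms(2))
  moreover have "(b * p) ^ n = b ^ n * p ^ n"
  proof (induction n)
    case (Suc n)
    have "(b * p) ^ Suc n = b * (p * b ^ n) * p ^ n" by (simp add: Suc.IH mult.assoc)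
    also have "p * b ^ n = b ^ n * p" by (metis assms(1) power_commuting_commutes)
    finally show ?case by (simp add: mult.assoc)
  qed simp
  ultimately show ?thesis by simp
qed

text \<open>Brings quasinilpotence into the form \<open>b ^ n * p\<close>, which is what the limit
  condition on \<open>x\<close> amounts to.\<close>

lemma quasinilpotent_mult_idempotent_iff:
  fixes b p :: "'a::complex_banach_algebra_1"
  assumes "b * p = p * b" "p * p = p"
  shows "quasinilpotent (b * p) \<longleftrightarrow> (\<lambda>n. root n (norm (b ^ n * p))) \<longlonglongrightarrow> 0"
  unfolding quasinilpotent_def
proof (rule tendsto_cong)
  show "\<forall>\<^sub>F n in sequentially. root n (norm ((b * p) ^ n)) = root n (norm (b ^ n * p))"
    using eventually_gt_at_top[of 0]
    by eventually_elim (simp add: power_mult_idempotent[OF assms])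
qed

text \<open>The inverse is \<open>y + p * u\<close>, where \<open>u\<close> inverts
  \<open>1 + b * p\<close>: \<open>y\<close> handles the corner of \<open>1 - p\<close> and
  \<open>p * u\<close> that of \<open>p\<close>.\<close>

lemma invertible_element_add_idempotent:
  fixes b p y :: "'a::complex_banach_algebra_1"
  assumes b_y: "b * y = 1 - p" and y_b: "y * b = 1 - p" and py: "p * y = 0" and yp: "y * p = 0"
    and bp: "b * p = p * b" and pp: "p * p = p" and "quasinilpotent (b * p)"
  shows "invertible_element (b + p)"
proof -
  have "invertible_element (1 - - (b * p))"
    using assms(7) by (intro invertible_element_one_minus)
      (simp only: quasinilpotent_minus flip: quasinilpotent_def)
  then obtain u where u: "(1 + b * p) * u = 1" "u * (1 + b * p) = 1"
    unfolding invertible_element_def by auto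
  have "p * (1 + b * p) = (1 + b * p) * p"
    by (metis bp distrib_left distrib_right mult.assoc mult_1_left mult_1_right)
  then have pu: "p * u = u * p" by (rule commute_inverse[OF u])
  have bpp: "(b + p) * p = p * (1 + b * p)" "p * (b + p) = (1 + b * p) * p"
    using bp pp by (simp_all add: algebra_simps) (metis mult.assoc)+
  have "(b + p) * (y + p * u) = b * y + p * y + ((b + p) * p) * u"
    by (simp add: algebra_simps)
  also have "\<dots> = 1" unfolding bpp by (simp add: b_y py mult.assoc u)
  finally have right: "(b + p) * (y + p * u) = 1" .
  have "(y + p * u) * (b + p) = y * b + y * p + u * (p * (b + p))"
    unfolding pu by (simp add: algebra_simps)
  also have "\<dots> = 1" unfolding bpp by (simp add: y_b yp u flip: mult.assoc)
  finally show ?thesis using right unfolding invertible_element_def by blast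
qed

section \<open>Commutation of \<open>b\<close> and \<open>y\<close>\<close>

lemma power_mult_power_cancel:
  fixes b y :: "'a::monoid_mult"
  assumes "b * (y * y) = y"
  shows "b ^ n * y ^ Suc n = y"
proof (induction n)
  case (Suc n)
  have "b ^ Suc n * y ^ Suc (Suc n) = b ^ n * (b * (y * y)) * y ^ n"
    by (simp only: power_Suc2[of b] power_Suc[of y] mult.assoc)
  also have "\<dots> = b ^ n * y ^ Suc n" by (simp add: assms mult.assoc)
  finally show ?case using Suc.IH by simp
qed simp

lemma commuting_inner_inverse:
  fixes b y :: "'a::complex_banach_algebra_1"
  assumes star: "\<And>x y. star (x * y) = star y * star x"
    and byy: "b * (y * y) = y"
    and sby: "star (b * y) = b * y" and syb: "star (y * b) = y * b"
    and lim: "(\<lambda>n. root n (norm (b ^ n - y * b ^ Suc n))) \<longlonglongrightarrow> 0"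
  shows "b * y = y * b" "y * b * y = y"
proof -
  have pow: "b ^ n * y ^ Suc n = y" for n by (rule power_mult_power_cancel[OF byy])
  \<comment> \<open>Multiplying the decaying term by \<open>y ^ Suc n\<close> collapses both of its
    summands, because \<open>b ^ n * y ^ Suc n = y\<close>.\<close>
  have "y - y * b * y = (b ^ n - y * b ^ Suc n) * (y ^ n * y)" for n
  proof -
    have "(b ^ n - y * b ^ Suc n) * (y ^ n * y) = b ^ n * y ^ Suc n - y * (b * (b ^ n * y ^ Suc n))"
      by (simp add: algebra_simps power_commutes)
    then show ?thesis unfolding pow by (simp add: mult.assoc)
  qed
  from eq_0_if_root_norm_tendsto_0[OF lim this]
  show yby: "y * b * y = y" by simp
  \<comment> \<open>The same argument with last factor \<open>b * y\<close>, which
    \<open>y ^ n\<close> absorbs for \<open>n > 0\<close> by \<open>y * b * y = y\<close>;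
    \<open>n = 0\<close> is immediate.\<close>
  have "b * y - y * b * (b * y) = (b ^ n - y * b ^ Suc n) * (y ^ n * (b * y))" for n
  proof -
    have byp: "y ^ n * (b * y) = y ^ n" if "n > 0" for n
      using that yby by (cases n) (simp_all add: power_Suc2 mult.assoc del: power_Suc)
    have pow': "b ^ n * (y ^ n * (b * y)) = b * y"
    proof (cases n)
      case (Suc m)
      then show ?thesis using pow[of m] byp[of n] by (simp add: mult.assoc)
    qed simp
    have "(b ^ n - y * b ^ Suc n) * (y ^ n * (b * y))
        = b ^ n * (y ^ n * (b * y)) - y * (b * (b ^ n * (y ^ n * (b * y))))"
      by (simp add: algebra_simps)
    then show ?thesis unfolding pow' by (simp add: mult.assoc)
  qed
  from eq_0_if_root_norm_tendsto_0[OF lim this]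
  have "b * y = (y * b) * (b * y)" by simp
  \<comment> \<open>The adjoint reverses the two self-adjoint factors, bringing
    \<open>b * (y * y)\<close> together so that it contracts to \<open>y\<close>.\<close>
  also have "\<dots> = star ((b * y) * (y * b))" by (simp only: star[of "b * y" "y * b"] sby syb)
  also have "(b * y) * (y * b) = y * b" using byy by (metis mult.assoc)
  finally show "b * y = y * b" by (simp only: syb)
qed

section \<open>The two implications\<close>

lemma involution_one:
  assumes "involution star"
  shows "star 1 = 1"
  using assms unfolding involution_def by (metis mult_1_left mult_1_right)

lemma involution_one_minus:
  assumes "involution star"
  shows "star (1 - p) = 1 - star p"
proof -
  have "star (1 - p) + star p = star 1"
    using assms unfolding involution_def by (metis diff_add_cancel)
  then show ?thesis by (simp add: involution_one[OF assms] algebra_simps)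
qed

lemma generalized_EP_imp_projection:
  assumes inv: "involution star" and "generalized_EP star w a"
  shows "\<exists>p. p^2 = p \<and> p = star p \<and> invertible_element (a * w + p) \<and>
    1 - p \<in> left_multiples w \<and> a * w * p = p * a * w \<and> quasinilpotent (a * w * p)"
proof -
  from assms(2) obtain x where x: "a * (w * x)^2 = x"
    and s1: "star (a * w * x * w) = a * w * x * w"
    and s2: "star (x * w * a * w) = x * w * a * w"
    and lim: "(\<lambda>n. root n (norm ((a * w) ^ n - x * w * (a * w) ^ (n + 1)))) \<longlonglongrightarrow> 0"
    unfolding generalized_EP_def by blast
  define b y where "b = a * w" and "y = x * w"
  define p where "p = 1 - b * y"
  have star: "star (x * y) = star y * star x" for x y
    using inv by (simp add: involution_def)
  have "b * (y * y) = a * (w * x)^2 * w"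
    by (simp add: b_def y_def power2_eq_square mult.assoc)
  then have byy: "b * (y * y) = y" by (simp add: x y_def)
  have sby: "star (b * y) = b * y" "star (y * b) = y * b"
    using s1 s2 by (simp_all add: b_def y_def mult.assoc)
  have lim': "(\<lambda>n. root n (norm (b ^ n - y * b ^ Suc n))) \<longlonglongrightarrow> 0"
    using lim by (simp add: b_def y_def)
  note comm = commuting_inner_inverse[OF star byy sby lim']
  have py: "p * y = 0" using byy by (simp add: p_def algebra_simps)
  have yp: "y * p = 0" using comm by (simp add: p_def algebra_simps)
  have pp: "p * p = p" by (simp add: p_def[of] right_diff_distrib)
      (metis mult_zero_right mult.assoc p_def py comm(1) yp mult_zero_left diff_zero)
  have bp: "b * p = p * b"
    using comm(1) by (simp add: p_def right_diff_distrib left_diff_distrib) (metis mult.assoc)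
  \<comment> \<open>Since \<open>p = 1 - y * b\<close> as well, the limit condition says exactly
    that \<open>b * p\<close> is quasinilpotent.\<close>
  have "b ^ n * p = b ^ n - y * b ^ Suc n" for n
  proof -
    have "b ^ n * p = p * b ^ n" using bp by (simp add: power_commuting_commutes)
    then show ?thesis by (simp add: p_def comm(1) left_diff_distrib mult.assoc)
  qed
  then have qn: "quasinilpotent (b * p)"
    using lim' by (simp add: quasinilpotent_mult_idempotent_iff[OF bp pp])
  have "invertible_element (b + p)"
    by (rule invertible_element_add_idempotent[OF _ _ py yp bp pp qn]) (simp_all add: p_def comm(1))
  moreover have "1 - p \<in> left_multiples w"
    unfolding left_multiples_def p_def b_def y_def by (auto intro!: exI[of _ "a * w * x"] simp: mult.assoc)
  moreover have "star p = p"
    by (simp add: p_def involution_one_minus[OF inv] sby)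
  ultimately show ?thesis
    using pp bp qn by (intro exI[of _ p]) (simp add: power2_eq_square b_def mult.assoc)
qed

lemma projection_imp_generalized_EP:
  assumes inv: "involution star" and "p^2 = p" and sp: "p = star p"
    and invt: "invertible_element (a * w + p)" and "1 - p \<in> left_multiples w"
    and "a * w * p = p * a * w" and qn: "quasinilpotent (a * w * p)"
  shows "generalized_EP star w a"
proof -
  define b where "b = a * w"
  have bp: "b * p = p * b" using assms(6) by (simp add: b_def mult.assoc)
  have pp: "p * p = p" using assms(2) by (simp add: power2_eq_square)
  obtain u where u: "1 - p = u * w" using assms(5) unfolding left_multiples_def by auto
  obtain v where v: "(b + p) * v = 1" "v * (b + p) = 1"
    using invt unfolding invertible_element_def b_def by auto
  have pv: "p * v = v * p"
    by (rule commute_inverse[OF v]) (simp add: algebra_simps bp)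
  \<comment> \<open>This is the inverse of \<open>b\<close> on the corner of \<open>1 - p\<close>,
    where \<open>b\<close> and \<open>b + p\<close> agree.\<close>
  define y where "y = v * (1 - p)"
  have py: "p * y = 0" by (simp add: y_def pv pp right_diff_distrib flip: mult.assoc)
      (simp add: mult.assoc pp)
  have "b * y = (b + p) * y" by (simp add: distrib_right py)
  also have "\<dots> = 1 - p" by (simp add: y_def v flip: mult.assoc)
  finally have b_y: "b * y = 1 - p" .
  have "y * b = v * ((1 - p) * b)" by (simp add: y_def mult.assoc)
  also have "(1 - p) * b = (b + p) * (1 - p)" by (simp add: algebra_simps bp pp)
  finally have y_b: "y * b = 1 - p" by (simp add: v flip: mult.assoc)
  \<comment> \<open>The factor \<open>u\<close> makes \<open>x * w = y * (1 - p) = y\<close>; this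
    is where \<open>1 - p\<close> being a left multiple of \<open>w\<close> enters.\<close>
  define x where "x = y * u"
  have xw: "x * w = y"
    by (simp add: x_def mult.assoc flip: u) (simp add: y_def algebra_simps pp)
  have "a * (w * x)^2 = b * (x * w) * x" by (simp add: b_def power2_eq_square mult.assoc)
  also have "\<dots> = x - p * y * u" unfolding xw b_y by (simp add: left_diff_distrib x_def mult.assoc)
  finally have "a * (w * x)^2 = x" by (simp add: py)
  moreover have "a * w * x * w = 1 - p" "x * w * a * w = 1 - p"
    using b_y y_b by (simp_all add: b_def mult.assoc flip: xw)
  moreover have "star (1 - p) = 1 - p"
    using sp by (simp add: involution_one_minus[OF inv])
  moreover have "b ^ n - x * w * b ^ (n + 1) = b ^ n * p" for n
  proof -
    have "x * w * b ^ (n + 1) = (y * b) * b ^ n" by (simp add: xw mult.assoc)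
    also have "\<dots> = b ^ n - p * b ^ n" by (simp add: y_b left_diff_distrib)
    also have "p * b ^ n = b ^ n * p" using bp by (metis power_commuting_commutes)
    finally show ?thesis by simp
  qed
  ultimately show ?thesis
    using qn quasinilpotent_mult_idempotent_iff[OF bp pp]
    unfolding generalized_EP_def by (intro exI[of _ x]) (simp add: b_def)
qed

theorem theorem3p5:
  fixes star :: "'a::complex_banach_algebra_1 \<Rightarrow> 'a" and a w :: 'a
  assumes "involution star"
  shows "generalized_EP star w a \<longleftrightarrow>
    (\<exists>p. p^2 = p \<and> p = star p \<and>
         invertible_element (a * w + p) \<and>
         1 - p \<in> left_multiples w \<and>
         a * w * p = p * a * w \<and> quasinilpotent (a * w * p))"
  using generalized_EP_imp_projection[OF assms] projection_imp_generalized_EP[OF assms] by blast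

end
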